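(* Let $T$ be a rooted homogeneous tree of order $\gamma$. If $B$ is the backward shift on $\mathcal{L}$, then $$\sigma(B)=\sigma_{\mathrm{ap}}(B)=\sigma_{\mathrm{p}}(B)=\{\lambda\in\mathbb{C}:|\lambda|\le\gamma\}.$$
   Context: A tree is an undirected graph (no loops or multiple edges) in which any two vertices are joined by exactly one path; $T$ also denotes its vertex set, which is assumed countably infinite, and every vertex has finite degree. $T$ has a distinguished vertex $o$, the root. For $v\neq o$, the parent $\mathrm{par}(v)$ is the vertex preceding $v$ on the unique path from $o$ to $v$; $\mathrm{Chi}(v)$ is the set of children of $v$ (vertices with parent $v$), and $\gamma(v)$ is its cardinality. $T$ is homogeneous of order $\gamma$ if $\gamma(v)=\gamma$ for all $v\in T$ (so $\gamma\geq 1$). For $f:T\to\mathbb{C}$ define $f'(o)=f(o)$ and $f'(v)=f(v)-f(\mathrm{par}(v))$ for $v\neq o$. The Lipschitz space $\mathcal{L}$ is the Banach space of all $f:T\to\mathbb{C}$ with $f'$ bounded, with norm $\|f\|=\sup_{v\in T}|f'(v)|$. The backward shift is $(Bf)(v)=\sum_{w\in\mathrm{Chi}(v)}f(w)$; it is bounded on $\mathcal{L}$ for homogeneous $T$. $\sigma$, $\sigma_{\mathrm{ap}}$, $\sigma_{\mathrm{p}}$ denote the spectrum, the approximate point spectrum and the set of eigenvalues. *)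

theory Defs imports "HOL-Analysis.Analysis" begin

section \<open>Rooted trees\<close>

text \<open>The vertex set is the whole type \<^typ>\<open>'v\<close>, so that functions on the tree are
  exactly the functions \<^typ>\<open>'v \<Rightarrow> complex\<close>. The edges are given by an adjacency relation.\<close>

definition path_from_to :: "('v \<Rightarrow> 'v \<Rightarrow> bool) \<Rightarrow> 'v \<Rightarrow> 'v \<Rightarrow> 'v list \<Rightarrow> bool" where
  "path_from_to adj u v p \<longleftrightarrow>
     p \<noteq> [] \<and> hd p = u \<and> last p = v \<and> distinct p \<and> successively adj p"

definition infinite_tree :: "('v \<Rightarrow> 'v \<Rightarrow> bool) \<Rightarrow> bool" where
  "infinite_tree adj \<longleftrightarrow>
     symp adj \<and> irreflp adj \<and>
     (\<forall>u v. \<exists>!p. path_from_to adj u v p) \<and>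
     countable (UNIV :: 'v set) \<and> infinite (UNIV :: 'v set) \<and>
     (\<forall>v. finite {w. adj v w})"

text \<open>The value of \<open>par adj r v\<close> is meaningful only for \<open>v \<noteq> r\<close>.\<close>

definition par :: "('v \<Rightarrow> 'v \<Rightarrow> bool) \<Rightarrow> 'v \<Rightarrow> 'v \<Rightarrow> 'v" where
  "par adj r v = last (butlast (THE p. path_from_to adj r v p))"

definition Chi :: "('v \<Rightarrow> 'v \<Rightarrow> bool) \<Rightarrow> 'v \<Rightarrow> 'v \<Rightarrow> 'v set" where
  "Chi adj r v = {w. w \<noteq> r \<and> par adj r w = v}"

definition homogeneous_of_order :: "('v \<Rightarrow> 'v \<Rightarrow> bool) \<Rightarrow> 'v \<Rightarrow> nat \<Rightarrow> bool" where
  "homogeneous_of_order adj r \<gamma> \<longleftrightarrow> (\<forall>v. card (Chi adj r v) = \<gamma>)"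

section \<open>The Lipschitz space and the backward shift\<close>

definition tree_deriv ::
    "('v \<Rightarrow> 'v \<Rightarrow> bool) \<Rightarrow> 'v \<Rightarrow> ('v \<Rightarrow> complex) \<Rightarrow> 'v \<Rightarrow> complex" where
  "tree_deriv adj r f v = (if v = r then f r else f v - f (par adj r v))"

definition Lip :: "('v \<Rightarrow> 'v \<Rightarrow> bool) \<Rightarrow> 'v \<Rightarrow> ('v \<Rightarrow> complex) set" where
  "Lip adj r = {f. bounded (range (tree_deriv adj r f))}"

definition Lip_norm :: "('v \<Rightarrow> 'v \<Rightarrow> bool) \<Rightarrow> 'v \<Rightarrow> ('v \<Rightarrow> complex) \<Rightarrow> real" where
  "Lip_norm adj r f = (SUP v. cmod (tree_deriv adj r f v))"

definition backward_shift ::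
    "('v \<Rightarrow> 'v \<Rightarrow> bool) \<Rightarrow> 'v \<Rightarrow> ('v \<Rightarrow> complex) \<Rightarrow> ('v \<Rightarrow> complex)" where
  "backward_shift adj r f v = (\<Sum>w\<in>Chi adj r v. f w)"

section \<open>Spectra of operators on normed spaces of complex functions\<close>

text \<open>Here \<open>X\<close> is a complex vector space of functions under the pointwise operations and
  \<open>N\<close> is a norm on \<open>X\<close>. Operators are only relevant on \<open>X\<close>; their values elsewhere are ignored.\<close>

definition bounded_operator ::
    "('v \<Rightarrow> complex) set \<Rightarrow> (('v \<Rightarrow> complex) \<Rightarrow> real) \<Rightarrow>
     (('v \<Rightarrow> complex) \<Rightarrow> ('v \<Rightarrow> complex)) \<Rightarrow> bool" where
  "bounded_operator X N A \<longleftrightarrow>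
     (\<forall>f\<in>X. A f \<in> X) \<and>
     (\<forall>f\<in>X. \<forall>g\<in>X. A (\<lambda>v. f v + g v) = (\<lambda>v. A f v + A g v)) \<and>
     (\<forall>c. \<forall>f\<in>X. A (\<lambda>v. c * f v) = (\<lambda>v. c * A f v)) \<and>
     (\<exists>K. \<forall>f\<in>X. N (A f) \<le> K * N f)"

definition spectrum ::
    "('v \<Rightarrow> complex) set \<Rightarrow> (('v \<Rightarrow> complex) \<Rightarrow> real) \<Rightarrow>
     (('v \<Rightarrow> complex) \<Rightarrow> ('v \<Rightarrow> complex)) \<Rightarrow> complex set" where
  "spectrum X N A = {\<mu>. \<not> (\<exists>R. bounded_operator X N R \<and>
     (\<forall>f\<in>X. R (\<lambda>v. A f v - \<mu> * f v) = f) \<and>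
     (\<forall>f\<in>X. (\<lambda>v. A (R f) v - \<mu> * R f v) = f))}"

definition approx_point_spectrum ::
    "('v \<Rightarrow> complex) set \<Rightarrow> (('v \<Rightarrow> complex) \<Rightarrow> real) \<Rightarrow>
     (('v \<Rightarrow> complex) \<Rightarrow> ('v \<Rightarrow> complex)) \<Rightarrow> complex set" where
  "approx_point_spectrum X N A = {\<mu>. \<exists>f :: nat \<Rightarrow> 'v \<Rightarrow> complex.
     (\<forall>n. f n \<in> X \<and> N (f n) = 1) \<and>
     (\<lambda>n. N (\<lambda>v. A (f n) v - \<mu> * f n v)) \<longlonglongrightarrow> 0}"

definition point_spectrum ::
    "('v \<Rightarrow> complex) set \<Rightarrow> (('v \<Rightarrow> complex) \<Rightarrow> ('v \<Rightarrow> complex)) \<Rightarrow> complex set" where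
  "point_spectrum X A = {\<mu>. \<exists>f\<in>X. f \<noteq> (\<lambda>v. 0) \<and> A f = (\<lambda>v. \<mu> * f v)}"

section \<open>Boundedness of the backward shift\<close>

lemma cmod_tree_deriv_le:
  assumes "f \<in> Lip adj r"
  shows "cmod (tree_deriv adj r f v) \<le> Lip_norm adj r f"
proof -
  have "bdd_above (range (\<lambda>v. cmod (tree_deriv adj r f v)))"
    using assms unfolding Lip_def bounded_iff bdd_above_def by auto
  then show ?thesis
    unfolding Lip_norm_def by (rule cSUP_upper[OF UNIV_I])
qed

lemma bounded_operator_backward_shift:
  assumes hom: "homogeneous_of_order adj r \<gamma>"
  shows "bounded_operator (Lip adj r) (Lip_norm adj r) (backward_shift adj r)"
proof -
  let ?B = "backward_shift adj r"
  have card: "card (Chi adj r v) = \<gamma>" for v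
    using hom by (simp add: homogeneous_of_order_def)
  have near: "cmod (?B f v - of_nat \<gamma> * f v) \<le> real \<gamma> * Lip_norm adj r f"
    if f: "f \<in> Lip adj r" for f v
  proof -
    have "?B f v - of_nat \<gamma> * f v = (\<Sum>w\<in>Chi adj r v. f w - f v)"
      by (simp add: backward_shift_def sum_subtractf card)
    moreover have "cmod (f w - f v) \<le> Lip_norm adj r f" if "w \<in> Chi adj r v" for w
      using cmod_tree_deriv_le[OF f, of w] that by (auto simp: tree_deriv_def Chi_def)
    ultimately show ?thesis
      using sum_norm_bound[of "Chi adj r v" "\<lambda>w. f w - f v" "Lip_norm adj r f"] card by simp
  qed
  have bound: "cmod (tree_deriv adj r (?B f) v) \<le> 3 * real \<gamma> * Lip_norm adj r f"
    if f: "f \<in> Lip adj r" for f v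
  proof -
    have d: "cmod (of_nat \<gamma> * tree_deriv adj r f v) \<le> real \<gamma> * Lip_norm adj r f"
      using cmod_tree_deriv_le[OF f, of v] by (simp add: norm_mult mult_left_mono)
    have "0 \<le> Lip_norm adj r f"
      using cmod_tree_deriv_le[OF f, of v] norm_ge_zero order_trans by blast
    then have nonneg: "0 \<le> real \<gamma> * Lip_norm adj r f" by simp
    show ?thesis
    proof (cases "v = r")
      case True
      have "cmod (?B f r) \<le> cmod (?B f r - of_nat \<gamma> * f r) + cmod (of_nat \<gamma> * f r)"
        using norm_triangle_ineq[of "?B f r - of_nat \<gamma> * f r" "of_nat \<gamma> * f r"] by simp
      then show ?thesis
        using True near[OF f, of r] d nonneg by (simp add: tree_deriv_def)
    next
      case False
      let ?p = "par adj r v"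
      have "?B f v - ?B f ?p = (?B f v - of_nat \<gamma> * f v) + of_nat \<gamma> * (f v - f ?p)
              - (?B f ?p - of_nat \<gamma> * f ?p)"
        by (simp add: algebra_simps)
      then have "cmod (?B f v - ?B f ?p) \<le> cmod (?B f v - of_nat \<gamma> * f v)
              + cmod (of_nat \<gamma> * (f v - f ?p)) + cmod (?B f ?p - of_nat \<gamma> * f ?p)"
        by (metis norm_triangle_ineq norm_triangle_ineq4 add_right_mono order_trans)
      then show ?thesis
        using False near[OF f, of v] near[OF f, of ?p] d by (simp add: tree_deriv_def)
    qed
  qed
  have "?B f \<in> Lip adj r" if "f \<in> Lip adj r" for f
    using bound[OF that] unfolding Lip_def bounded_iff by auto
  moreover have "Lip_norm adj r (?B f) \<le> 3 * real \<gamma> * Lip_norm adj r f"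
    if "f \<in> Lip adj r" for f
    using bound[OF that] unfolding Lip_norm_def[of _ _ "?B f"] by (intro cSUP_least) auto
  ultimately show ?thesis
    unfolding bounded_operator_def
    by (auto simp: backward_shift_def sum.distrib sum_distrib_left)
qed

end

theory Submission imports Defs begin

text \<open>
  Let \<open>q = \<lambda> / \<gamma>\<close> with \<open>|\<lambda>| \<le> \<gamma>\<close>. Every vertex has \<open>\<gamma>\<close> children, one level deeper, so the function
  \<open>v \<mapsto> q ^ depth v\<close> is an eigenvector of \<open>B\<close> for \<open>\<gamma> q = \<lambda>\<close>; it is bounded because \<open>|q| \<le> 1\<close>, hence
  it is in the Lipschitz space. So the closed disc of radius \<open>\<gamma>\<close> consists of eigenvalues, and as usual
  eigenvalues are approximate eigenvalues, and these lie in the spectrum.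

  It remains to invert \<open>B - \<lambda>\<close> for \<open>|\<lambda>| > \<gamma>\<close>. The powers of \<open>B\<close> grow at most
  like \<open>n \<gamma>^n\<close>: the value \<open>B^n f v\<close> is the sum of \<open>f\<close> over the \<open>\<gamma>^n\<close> descendants of \<open>v\<close> at distance \<open>n\<close>, and at each of them
  \<open>f\<close> differs from \<open>f v\<close> by at most \<open>n \<parallel>f\<parallel>\<close>. Comparing a vertex with its parent gives
  \<open>\<parallel>B^n f\<parallel> \<le> (2 n + 1) \<gamma>^n \<parallel>f\<parallel>\<close> (lemma \<open>cmod_tree_deriv_iterate_le\<close>), so the Neumann series of the
  resolvent converges for all \<open>|\<lambda>| > \<gamma>\<close>. The series is summed pointwise, and the same bound, summed
  over \<open>n\<close>, shows that the resulting operator maps the Lipschitz space to itself and is bounded.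
\<close>

section \<open>Depth in a rooted tree\<close>

definition depth :: "('v \<Rightarrow> 'v \<Rightarrow> bool) \<Rightarrow> 'v \<Rightarrow> 'v \<Rightarrow> nat" where
  "depth adj r v = length (THE p. path_from_to adj r v p) - 1"

lemma the_path:
  assumes "infinite_tree adj"
  shows "path_from_to adj u v (THE p. path_from_to adj u v p)"
  using assms unfolding infinite_tree_def by (blast intro: theI')

lemma the_path_eqI:
  assumes "infinite_tree adj" "path_from_to adj u v p"
  shows "(THE p. path_from_to adj u v p) = p"
  using assms unfolding infinite_tree_def by (blast intro: the1_equality)

text \<open>Removing the last vertex of the path from the root to \<open>w\<close> leaves the path to the parent of \<open>w\<close>,
  by uniqueness of paths.\<close>

lemma par_properties:
  assumes tree: "infinite_tree adj" and w: "w \<noteq> r"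
  shows depth_par: "depth adj r w = Suc (depth adj r (par adj r w))"
    and adj_par: "adj (par adj r w) w"
proof -
  define p where "p = (THE p. path_from_to adj r w p)"
  have p: "p \<noteq> []" "hd p = r" "last p = w" "distinct p" "successively adj p"
    using the_path[OF tree, of r w] by (auto simp: p_def path_from_to_def)
  define q where "q = butlast p"
  have pq: "p = q @ [w]"
    using p by (metis append_butlast_last_id q_def)
  have q: "q \<noteq> []"
    using pq p w by auto
  have par: "par adj r w = last q"
    by (simp add: par_def q_def p_def)
  show "adj (par adj r w) w"
    using p(5) q unfolding pq par by (simp add: successively_append_iff)
  have "path_from_to adj r (par adj r w) q"
    using p q unfolding pq par path_from_to_def by (auto simp: successively_append_iff)
  then have "(THE p. path_from_to adj r (par adj r w) p) = q"
    by (rule the_path_eqI[OF tree])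
  then show "depth adj r w = Suc (depth adj r (par adj r w))"
    using q unfolding depth_def p_def[symmetric] pq by (cases q) auto
qed

lemma depth_root:
  assumes "infinite_tree adj"
  shows "depth adj r r = 0"
proof -
  have "path_from_to adj r r [r]"
    by (simp add: path_from_to_def)
  then show ?thesis
    using the_path_eqI[OF assms] by (simp add: depth_def)
qed

text \<open>For \<open>\<gamma> = 0\<close> the root would be the only vertex. Finiteness of the degrees matters here, since an
  infinite set of children also has \<open>card\<close> equal to \<open>0\<close>.\<close>

lemma homogeneous_order_pos:
  assumes tree: "infinite_tree adj" and hom: "homogeneous_of_order adj r \<gamma>"
  shows "\<gamma> > 0"
proof (rule ccontr)
  assume "\<not> \<gamma> > 0"
  then have card: "card (Chi adj r v) = 0" for v
    using hom by (simp add: homogeneous_of_order_def)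
  have "Chi adj r v \<subseteq> {w. adj v w}" for v
    using adj_par[OF tree] by (auto simp: Chi_def)
  moreover have "finite {w. adj v w}" for v
    using tree by (simp add: infinite_tree_def)
  ultimately have "Chi adj r v = {}" for v
    using card by (meson card_0_eq finite_subset)
  then have "v = r" for v
    by (auto simp: Chi_def)
  then have "(UNIV :: 'a set) = {r}"
    by auto
  then show False
    using tree by (metis finite.emptyI finite.insertI infinite_tree_def)
qed

section \<open>The Lipschitz norm\<close>

lemma Lip_norm_le:
  assumes "\<And>v. cmod (tree_deriv adj r f v) \<le> C"
  shows "f \<in> Lip adj r" "Lip_norm adj r f \<le> C"
  using assms unfolding Lip_def bounded_iff Lip_norm_def by (auto intro: cSUP_least)

lemma Lip_norm_nonneg:
  assumes "f \<in> Lip adj r"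
  shows "0 \<le> Lip_norm adj r f"
  using cmod_tree_deriv_le[OF assms] norm_ge_zero order_trans by blast

lemma tree_deriv_diff:
  "tree_deriv adj r (\<lambda>v. f v - g v) v = tree_deriv adj r f v - tree_deriv adj r g v"
  by (simp add: tree_deriv_def)

lemma tree_deriv_cmult:
  "tree_deriv adj r (\<lambda>v. c * f v) v = c * tree_deriv adj r f v"
  by (simp add: tree_deriv_def algebra_simps)

lemma Lip_diff:
  assumes "f \<in> Lip adj r" "g \<in> Lip adj r"
  shows "(\<lambda>v. f v - g v) \<in> Lip adj r"
  using norm_triangle_le_diff[OF add_mono[OF cmod_tree_deriv_le[OF assms(1)]
      cmod_tree_deriv_le[OF assms(2)]]]
  by (intro Lip_norm_le(1)) (simp only: tree_deriv_diff)

lemma Lip_cmult: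
  assumes "f \<in> Lip adj r"
  shows "(\<lambda>v. c * f v) \<in> Lip adj r"
    and "Lip_norm adj r (\<lambda>v. c * f v) \<le> cmod c * Lip_norm adj r f"
proof -
  have "cmod (tree_deriv adj r (\<lambda>v. c * f v) v) \<le> cmod c * Lip_norm adj r f" for v
    using cmod_tree_deriv_le[OF assms] by (simp add: tree_deriv_cmult norm_mult mult_left_mono)
  from Lip_norm_le[OF this]
  show "(\<lambda>v. c * f v) \<in> Lip adj r"
    and "Lip_norm adj r (\<lambda>v. c * f v) \<le> cmod c * Lip_norm adj r f" .
qed

lemma Lip_norm_cmult:
  assumes f: "f \<in> Lip adj r"
  shows "Lip_norm adj r (\<lambda>v. c * f v) = cmod c * Lip_norm adj r f"
proof (cases "c = 0")
  case True
  then show ?thesis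
    by (simp add: Lip_norm_def tree_deriv_def if_distrib cong: if_cong)
next
  case False
  \<comment> \<open>The upper bound, applied to \<open>c f\<close> and the factor \<open>1 / c\<close>, is the lower bound.\<close>
  have "Lip_norm adj r f \<le> cmod (1 / c) * Lip_norm adj r (\<lambda>v. c * f v)"
    using Lip_cmult(2)[OF Lip_cmult(1)[OF f, of c], of "1 / c"] False by simp
  then show ?thesis
    using Lip_cmult(2)[OF f, of c] False by (simp add: norm_divide field_simps)
qed

text \<open>A function with vanishing differences vanishes at the root and is propagated unchanged from
  parent to child.\<close>

lemma Lip_norm_eq_0D:
  assumes tree: "infinite_tree adj" and f: "f \<in> Lip adj r" and 0: "Lip_norm adj r f = 0"
  shows "f = (\<lambda>v. 0)"
proof
  have d: "tree_deriv adj r f v = 0" for v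
    using cmod_tree_deriv_le[OF f, of v] 0 by simp
  fix v
  show "f v = 0"
  proof (induction "depth adj r v" arbitrary: v rule: less_induct)
    case less
    show ?case
    proof (cases "v = r")
      case True
      then show ?thesis using d[of r] by (simp add: tree_deriv_def)
    next
      case False
      then have "f (par adj r v) = 0"
        using less depth_par[OF tree False] by simp
      then show ?thesis using d[of v] False by (simp add: tree_deriv_def)
    qed
  qed
qed

section \<open>Inclusions between the parts of the spectrum\<close>

text \<open>Normalise an eigenvector and take the constant sequence.\<close>

lemma point_spectrum_subset_approx_point_spectrum:
  assumes cmult: "\<And>f c. f \<in> X \<Longrightarrow> (\<lambda>v. c * f v) \<in> X"
    and norm_cmult: "\<And>f c. f \<in> X \<Longrightarrow> N (\<lambda>v. c * f v) = cmod c * N f"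
    and definite: "\<And>f. f \<in> X \<Longrightarrow> N f = 0 \<Longrightarrow> f = (\<lambda>v. 0)"
    and nonneg: "\<And>f. f \<in> X \<Longrightarrow> 0 \<le> N f"
    and A: "bounded_operator X N A"
  shows "point_spectrum X A \<subseteq> approx_point_spectrum X N A"
proof
  fix \<mu> assume "\<mu> \<in> point_spectrum X A"
  then obtain f where f: "f \<in> X" "f \<noteq> (\<lambda>v. 0)" "A f = (\<lambda>v. \<mu> * f v)"
    by (auto simp: point_spectrum_def)
  have Nf: "N f > 0"
    using definite[OF f(1)] nonneg[OF f(1)] f(2) by fastforce
  define g where "g = (\<lambda>v. of_real (1 / N f) * f v)"
  have g: "g \<in> X" "N g = 1"
    using cmult[OF f(1), of "of_real (1 / N f)"] norm_cmult[OF f(1), of "of_real (1 / N f)"] Nf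
    by (simp_all add: g_def norm_divide)
  have "A g = (\<lambda>v. of_real (1 / N f) * A f v)"
    using A f(1) unfolding bounded_operator_def g_def by blast
  then have "(\<lambda>v. A g v - \<mu> * g v) = (\<lambda>v. 0 * f v)"
    by (simp add: f(3) g_def)
  then have "N (\<lambda>v. A g v - \<mu> * g v) = 0"
    using norm_cmult[OF f(1), of 0] by simp
  then show "\<mu> \<in> approx_point_spectrum X N A"
    using g unfolding approx_point_spectrum_def by (intro CollectI exI[of _ "\<lambda>_. g"]) simp
qed

text \<open>A bounded inverse \<open>R\<close> of \<open>A - \<mu>\<close> gives \<open>1 = N (f n) \<le> K N ((A - \<mu>) (f n))\<close>, which keeps
  \<open>(A - \<mu>) (f n)\<close> away from \<open>0\<close>.\<close>

lemma approx_point_spectrum_subset_spectrum: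
  assumes diff: "\<And>f g. f \<in> X \<Longrightarrow> g \<in> X \<Longrightarrow> (\<lambda>v. f v - g v) \<in> X"
    and cmult: "\<And>f c. f \<in> X \<Longrightarrow> (\<lambda>v. c * f v) \<in> X"
    and A: "bounded_operator X N A"
  shows "approx_point_spectrum X N A \<subseteq> spectrum X N A"
proof
  fix \<mu> assume "\<mu> \<in> approx_point_spectrum X N A"
  then obtain f where f: "\<And>n::nat. f n \<in> X" "\<And>n. N (f n) = 1"
    and lim: "(\<lambda>n. N (\<lambda>v. A (f n) v - \<mu> * f n v)) \<longlonglongrightarrow> 0"
    by (auto simp: approx_point_spectrum_def)
  have "False" if R: "bounded_operator X N R" "\<forall>f\<in>X. R (\<lambda>v. A f v - \<mu> * f v) = f" for R
  proof -
    obtain K where K: "\<And>f. f \<in> X \<Longrightarrow> N (R f) \<le> K * N f"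
      using R(1) unfolding bounded_operator_def by blast
    have "A (f n) \<in> X" for n
      using A f(1) by (simp add: bounded_operator_def)
    then have "(\<lambda>v. A (f n) v - \<mu> * f n v) \<in> X" for n
      using diff cmult f(1) by blast
    then have "1 \<le> K * N (\<lambda>v. A (f n) v - \<mu> * f n v)" for n
      using K[of "\<lambda>v. A (f n) v - \<mu> * f n v"] R(2) f by simp
    moreover have "(\<lambda>n. K * N (\<lambda>v. A (f n) v - \<mu> * f n v)) \<longlonglongrightarrow> K * 0"
      by (intro tendsto_intros lim)
    ultimately show False
      using LIMSEQ_le_const[of _ "K * 0" "1 :: real"] by fastforce
  qed
  then show "\<mu> \<in> spectrum X N A"
    by (auto simp: spectrum_def)
qed

section \<open>Eigenvalues of the backward shift\<close>

lemma disc_subset_point_spectrum: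
  assumes tree: "infinite_tree adj" and hom: "homogeneous_of_order adj r \<gamma>"
  shows "{z. cmod z \<le> real \<gamma>} \<subseteq> point_spectrum (Lip adj r) (backward_shift adj r)"
proof
  fix \<mu> assume "\<mu> \<in> {z. cmod z \<le> real \<gamma>}"
  then have \<mu>: "cmod \<mu> \<le> real \<gamma>" by simp
  have \<gamma>: "\<gamma> > 0"
    using homogeneous_order_pos[OF tree hom] .
  define q where "q = \<mu> / of_nat \<gamma>"
  have q: "cmod q \<le> 1" "of_nat \<gamma> * q = \<mu>"
    using \<mu> \<gamma> by (simp_all add: q_def norm_divide)
  define f where "f = (\<lambda>v. q ^ depth adj r v)"
  have bounded: "cmod (f v) \<le> 1" for v
    using q by (simp add: f_def norm_power power_le_one)
  have "cmod (tree_deriv adj r f v) \<le> 2" for v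
    using norm_triangle_ineq4[of "f v" "f (par adj r v)"] bounded[of v] bounded[of "par adj r v"]
    by (auto simp: tree_deriv_def)
  then have "f \<in> Lip adj r"
    by (rule Lip_norm_le)
  moreover have "f r \<noteq> 0"
    by (simp add: f_def depth_root[OF tree])
  moreover have "backward_shift adj r f v = \<mu> * f v" for v
  proof -
    have "f w = q * f v" if "w \<in> Chi adj r v" for w
      using that depth_par[OF tree, of w r] by (auto simp: Chi_def f_def)
    then have "backward_shift adj r f v = of_nat (card (Chi adj r v)) * (q * f v)"
      by (simp add: backward_shift_def)
    then show ?thesis
      using hom q by (simp add: homogeneous_of_order_def flip: mult.assoc)
  qed
  ultimately show "\<mu> \<in> point_spectrum (Lip adj r) (backward_shift adj r)"
    unfolding point_spectrum_def by (intro CollectI bexI[of _ f]) auto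
qed

section \<open>Powers of the backward shift\<close>

lemma backward_shift_iterate_add:
  "(backward_shift adj r ^^ n) (\<lambda>v. f v + g v) =
     (\<lambda>v. (backward_shift adj r ^^ n) f v + (backward_shift adj r ^^ n) g v)"
  by (induction n) (auto simp: backward_shift_def sum.distrib)

lemma backward_shift_iterate_cmult:
  "(backward_shift adj r ^^ n) (\<lambda>v. c * f v) = (\<lambda>v. c * (backward_shift adj r ^^ n) f v)"
  by (induction n) (auto simp: backward_shift_def sum_distrib_left)

text \<open>Descending one generation multiplies the previous error by the \<open>\<gamma>\<close> children, and replacing the
  values of \<open>f\<close> at the children by \<open>f v\<close> costs one further \<open>\<gamma> ^ Suc n\<close> times the norm.\<close>

lemma iterate_near_multiple:
  assumes hom: "homogeneous_of_order adj r \<gamma>" and f: "f \<in> Lip adj r"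
  shows "cmod ((backward_shift adj r ^^ n) f v - of_nat \<gamma> ^ n * f v)
           \<le> real n * real \<gamma> ^ n * Lip_norm adj r f"
proof (induction n arbitrary: v)
  case 0
  show ?case by simp
next
  case (Suc n)
  let ?L = "Lip_norm adj r f" and ?F = "(backward_shift adj r ^^ n) f"
  have card: "card (Chi adj r v) = \<gamma>"
    using hom by (simp add: homogeneous_of_order_def)
  have "(backward_shift adj r ^^ Suc n) f v - of_nat \<gamma> ^ Suc n * f v =
      (\<Sum>w\<in>Chi adj r v. (?F w - of_nat \<gamma> ^ n * f w) + of_nat \<gamma> ^ n * (f w - f v))"
    by (simp add: backward_shift_def sum_subtractf sum.distrib right_diff_distrib card)
  also have "cmod \<dots> \<le> of_nat (card (Chi adj r v)) *
      (real n * real \<gamma> ^ n * ?L + real \<gamma> ^ n * ?L)"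
  proof (rule sum_norm_bound)
    fix w assume "w \<in> Chi adj r v"
    then have "cmod (f w - f v) \<le> ?L"
      using cmod_tree_deriv_le[OF f, of w] by (auto simp: tree_deriv_def Chi_def)
    then have "cmod (of_nat \<gamma> ^ n * (f w - f v)) \<le> real \<gamma> ^ n * ?L"
      by (simp add: norm_mult norm_power mult_left_mono)
    then show "cmod ((?F w - of_nat \<gamma> ^ n * f w) + of_nat \<gamma> ^ n * (f w - f v))
        \<le> real n * real \<gamma> ^ n * ?L + real \<gamma> ^ n * ?L"
      using Suc.IH[of w] by (intro norm_triangle_mono)
  qed
  finally show ?case
    by (simp add: card algebra_simps)
qed

lemma cmod_iterate_le:
  assumes hom: "homogeneous_of_order adj r \<gamma>" and f: "f \<in> Lip adj r"
  shows "cmod ((backward_shift adj r ^^ n) f v)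
           \<le> (real n * Lip_norm adj r f + cmod (f v)) * real \<gamma> ^ n"
proof -
  have "cmod ((backward_shift adj r ^^ n) f v)
      \<le> cmod ((backward_shift adj r ^^ n) f v - of_nat \<gamma> ^ n * f v) + cmod (of_nat \<gamma> ^ n * f v)"
    by (metis diff_add_cancel norm_triangle_ineq)
  then show ?thesis
    using iterate_near_multiple[OF assms, of n v] by (simp add: norm_mult norm_power algebra_simps)
qed

text \<open>Applying \<open>cmod_iterate_le\<close> at a vertex and at its parent would leave terms in \<open>cmod (f v)\<close>, which
  can be unbounded in \<open>v\<close>. Therefore \<open>\<gamma> ^ n * f\<close> is split off first; its differences are controlled by
  those of \<open>f\<close>.\<close>

lemma cmod_tree_deriv_iterate_le:
  assumes hom: "homogeneous_of_order adj r \<gamma>" and f: "f \<in> Lip adj r"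
  shows "cmod (tree_deriv adj r ((backward_shift adj r ^^ n) f) v)
           \<le> (2 * real n + 1) * real \<gamma> ^ n * Lip_norm adj r f"
proof -
  let ?D = "\<lambda>v. (backward_shift adj r ^^ n) f v - of_nat \<gamma> ^ n * f v"
  let ?e = "real n * real \<gamma> ^ n * Lip_norm adj r f"
  have e: "0 \<le> ?e"
    using Lip_norm_nonneg[OF f] by simp
  note D = iterate_near_multiple[OF hom f, of n]
  have "cmod (tree_deriv adj r ?D v) \<le> 2 * ?e"
  proof (cases "v = r")
    case True
    then show ?thesis using D[of r] e by (simp add: tree_deriv_def)
  next
    case False
    then show ?thesis
      using norm_triangle_ineq4[of "?D v" "?D (par adj r v)"] D[of v] D[of "par adj r v"]
      by (simp add: tree_deriv_def)
  qed
  moreover have "cmod (of_nat \<gamma> ^ n * tree_deriv adj r f v) \<le> real \<gamma> ^ n * Lip_norm adj r f"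
    using cmod_tree_deriv_le[OF f, of v] by (simp add: norm_mult norm_power mult_left_mono)
  moreover have "tree_deriv adj r ((backward_shift adj r ^^ n) f) v =
      tree_deriv adj r ?D v + of_nat \<gamma> ^ n * tree_deriv adj r f v"
    by (simp add: tree_deriv_diff tree_deriv_cmult)
  ultimately have "cmod (tree_deriv adj r ((backward_shift adj r ^^ n) f) v)
      \<le> 2 * ?e + real \<gamma> ^ n * Lip_norm adj r f"
    by (metis norm_triangle_mono)
  then show ?thesis
    by (simp add: algebra_simps)
qed

section \<open>The resolvent outside the disc\<close>

definition neumann_resolvent ::
    "('v \<Rightarrow> 'v \<Rightarrow> bool) \<Rightarrow> 'v \<Rightarrow> complex \<Rightarrow> ('v \<Rightarrow> complex) \<Rightarrow> ('v \<Rightarrow> complex)" where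
  "neumann_resolvent adj r \<mu> f v = - (\<Sum>n. (backward_shift adj r ^^ n) f v / \<mu> ^ Suc n)"

lemma summable_affine_geometric:
  fixes a b c :: real
  assumes "0 \<le> c" "c < m"
  shows "summable (\<lambda>n. (real n * a + b) * c ^ n / m ^ Suc n)"
proof -
  define x where "x = c / m"
  have x: "norm x < 1"
    using assms by (simp add: x_def)
  have "summable (\<lambda>n. (a / m) * (of_nat (Suc n) * x ^ n) + ((b - a) / m) * x ^ n)"
    by (intro summable_add summable_mult summable_geometric x
        sums_summable[OF geometric_deriv_sums[OF x]])
  moreover have "(a / m) * (of_nat (Suc n) * x ^ n) + ((b - a) / m) * x ^ n =
      (real n * a + b) * c ^ n / m ^ Suc n" for n
    using assms by (simp add: x_def power_divide field_simps)
  ultimately show ?thesis by simp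
qed

context
  fixes adj :: "'v \<Rightarrow> 'v \<Rightarrow> bool" and r :: 'v and \<gamma> :: nat and \<mu> :: complex
  assumes hom: "homogeneous_of_order adj r \<gamma>" and \<mu>: "real \<gamma> < cmod \<mu>"
begin

private abbreviation (input) "B \<equiv> backward_shift adj r"
private abbreviation (input) "R \<equiv> neumann_resolvent adj r \<mu>"

lemma summable_neumann:
  assumes f: "f \<in> Lip adj r"
  shows "summable (\<lambda>n. (B ^^ n) f v / \<mu> ^ Suc n)"
proof (rule summable_comparison_test'[where N = 0])
  show "summable (\<lambda>n. (real n * Lip_norm adj r f + cmod (f v)) * real \<gamma> ^ n / cmod \<mu> ^ Suc n)"
    using \<mu> by (intro summable_affine_geometric) auto
  show "norm ((B ^^ n) f v / \<mu> ^ Suc n)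
      \<le> (real n * Lip_norm adj r f + cmod (f v)) * real \<gamma> ^ n / cmod \<mu> ^ Suc n" for n
    using cmod_iterate_le[OF hom f, of n v]
    by (simp only: norm_divide norm_power) (intro divide_right_mono; simp)
qed

lemma neumann_resolvent_add:
  assumes "f \<in> Lip adj r" "g \<in> Lip adj r"
  shows "R (\<lambda>v. f v + g v) = (\<lambda>v. R f v + R g v)"
proof
  fix v
  show "R (\<lambda>v. f v + g v) v = R f v + R g v"
    using suminf_add[OF summable_neumann[OF assms(1), of v] summable_neumann[OF assms(2), of v],
        symmetric]
    by (simp add: neumann_resolvent_def backward_shift_iterate_add add_divide_distrib)
qed

lemma neumann_resolvent_cmult:
  assumes "f \<in> Lip adj r"
  shows "R (\<lambda>v. c * f v) = (\<lambda>v. c * R f v)"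
  using suminf_mult[OF summable_neumann[OF assms]]
  by (auto simp: neumann_resolvent_def backward_shift_iterate_cmult)

lemma neumann_resolvent_bounded:
  "\<exists>K. \<forall>f\<in>Lip adj r. R f \<in> Lip adj r \<and> Lip_norm adj r (R f) \<le> K * Lip_norm adj r f"
proof -
  define k where "k n = (real n * 2 + 1) * real \<gamma> ^ n / cmod \<mu> ^ Suc n" for n
  have k: "summable k"
    unfolding k_def using \<mu> by (intro summable_affine_geometric) auto
  have "cmod (tree_deriv adj r (R f) v) \<le> suminf k * Lip_norm adj r f"
    if f: "f \<in> Lip adj r" for f v
  proof -
    let ?t = "\<lambda>n. tree_deriv adj r ((B ^^ n) f) v / \<mu> ^ Suc n"
    note S = summable_neumann[OF f]
    have "tree_deriv adj r (R f) v = - (\<Sum>n. ?t n)"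
      using suminf_diff[OF S S, of v "par adj r v", symmetric]
      by (auto simp: tree_deriv_def neumann_resolvent_def diff_divide_distrib)
    moreover have "norm (?t n) \<le> k n * Lip_norm adj r f" for n
      using divide_right_mono[OF cmod_tree_deriv_iterate_le[OF hom f, of n v],
          of "cmod \<mu> ^ Suc n"]
      by (simp add: norm_divide norm_mult norm_power k_def algebra_simps)
    then have "norm (\<Sum>n. ?t n) \<le> (\<Sum>n. k n * Lip_norm adj r f)"
      by (intro norm_suminf_le summable_mult2 k)
    ultimately show ?thesis
      using suminf_mult2[OF k] by simp
  qed
  then show ?thesis
    using Lip_norm_le by metis
qed

text \<open>The defining series telescopes: \<open>B^(n+1) f / \<mu>^(n+1) - B^n f / \<mu>^n\<close> sums to \<open>- f\<close>, since
  the terms of the convergent series \<open>R f\<close> tend to \<open>0\<close>.\<close>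

lemma neumann_telescope:
  assumes f: "f \<in> Lip adj r"
  shows "R (B f) v - \<mu> * R f v = f v"
proof -
  have Bf: "B f \<in> Lip adj r"
    using bounded_operator_backward_shift[OF hom] f by (simp add: bounded_operator_def)
  have \<mu>0: "\<mu> \<noteq> 0"
    using \<mu> by auto
  define a where "a n = (B ^^ n) f v / \<mu> ^ n" for n
  have a: "(B ^^ n) f v / \<mu> ^ Suc n * \<mu> = a n" for n
    using \<mu>0 by (simp add: a_def)
  have sum_a: "(\<lambda>n. a n) sums (- R f v * \<mu>)"
    using sums_mult2[OF summable_sums[OF summable_neumann[OF f]], of v \<mu>]
    unfolding a neumann_resolvent_def by simp
  have "(\<lambda>n. a (Suc n) - a n) sums (0 - a 0)"
    using sum_a by (intro telescope_sums summable_LIMSEQ_zero sums_summable)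
  moreover have "(\<lambda>n. a (Suc n)) sums (- R (B f) v)"
    using summable_sums[OF summable_neumann[OF Bf], of v]
    by (simp add: neumann_resolvent_def a_def funpow_swap1)
  ultimately have "- R (B f) v - (- R f v * \<mu>) = 0 - a 0"
    using sum_a by (blast intro: sums_unique2 sums_diff)
  then show ?thesis
    by (simp add: a_def algebra_simps)
qed

lemma neumann_resolvent_commute:
  assumes f: "f \<in> Lip adj r"
  shows "B (R f) = R (B f)"
proof
  fix v
  have "B (R f) v = - (\<Sum>w\<in>Chi adj r v. \<Sum>n. (B ^^ n) f w / \<mu> ^ Suc n)"
    by (simp add: backward_shift_def[of _ _ "R f"] neumann_resolvent_def sum_negf)
  also have "(\<Sum>w\<in>Chi adj r v. \<Sum>n. (B ^^ n) f w / \<mu> ^ Suc n) =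
      (\<Sum>n. \<Sum>w\<in>Chi adj r v. (B ^^ n) f w / \<mu> ^ Suc n)"
    by (intro suminf_sum[symmetric] summable_neumann f)
  also have "\<dots> = (\<Sum>n. (B ^^ n) (B f) v / \<mu> ^ Suc n)"
    by (simp add: sum_divide_distrib[symmetric] funpow_swap1[symmetric]
        backward_shift_def[of _ _ "(B ^^ _) f"])
  finally show "B (R f) v = R (B f) v"
    by (simp only: neumann_resolvent_def[of _ _ _ "B f"])
qed

lemma not_in_spectrum_backward_shift:
  "\<mu> \<notin> spectrum (Lip adj r) (Lip_norm adj r) B"
proof -
  have "bounded_operator (Lip adj r) (Lip_norm adj r) R"
    unfolding bounded_operator_def
    using neumann_resolvent_bounded neumann_resolvent_add neumann_resolvent_cmult by auto
  moreover have "R (\<lambda>v. B f v - \<mu> * f v) = f" if f: "f \<in> Lip adj r" for f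
  proof -
    have Bf: "B f \<in> Lip adj r"
      using bounded_operator_backward_shift[OF hom] f by (simp add: bounded_operator_def)
    have "R (\<lambda>v. B f v + (- \<mu>) * f v) = (\<lambda>v. R (B f) v + (- \<mu>) * R f v)"
      using neumann_resolvent_add[OF Bf Lip_cmult(1)[OF f, of "- \<mu>"]]
        neumann_resolvent_cmult[OF f, of "- \<mu>"] by simp
    then show ?thesis
      using neumann_telescope[OF f] by simp
  qed
  moreover have "(\<lambda>v. B (R f) v - \<mu> * R f v) = f" if f: "f \<in> Lip adj r" for f
    using neumann_telescope[OF f] neumann_resolvent_commute[OF f] by simp
  ultimately show ?thesis
    unfolding spectrum_def by blast
qed

end

theorem theorem6p2:
  fixes adj :: "'v \<Rightarrow> 'v \<Rightarrow> bool" and r :: 'v and \<gamma> :: nat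
  assumes "infinite_tree adj"
    and "homogeneous_of_order adj r \<gamma>"
  shows "spectrum (Lip adj r) (Lip_norm adj r) (backward_shift adj r) =
           approx_point_spectrum (Lip adj r) (Lip_norm adj r) (backward_shift adj r) \<and>
         approx_point_spectrum (Lip adj r) (Lip_norm adj r) (backward_shift adj r) =
           point_spectrum (Lip adj r) (backward_shift adj r) \<and>
         point_spectrum (Lip adj r) (backward_shift adj r) =
           {z :: complex. cmod z \<le> real \<gamma>}"
proof -
  let ?X = "Lip adj r" and ?N = "Lip_norm adj r" and ?B = "backward_shift adj r"
  note B = bounded_operator_backward_shift[OF assms(2)]
  have "point_spectrum ?X ?B \<subseteq> approx_point_spectrum ?X ?N ?B"
    using Lip_cmult(1) Lip_norm_cmult Lip_norm_eq_0D[OF assms(1)] Lip_norm_nonneg B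
    by (rule point_spectrum_subset_approx_point_spectrum)
  moreover have "approx_point_spectrum ?X ?N ?B \<subseteq> spectrum ?X ?N ?B"
    using Lip_diff Lip_cmult(1) B by (rule approx_point_spectrum_subset_spectrum)
  moreover have "spectrum ?X ?N ?B \<subseteq> {z. cmod z \<le> real \<gamma>}"
    using not_in_spectrum_backward_shift[OF assms(2)] by force
  moreover have "{z. cmod z \<le> real \<gamma>} \<subseteq> point_spectrum ?X ?B"
    using disc_subset_point_spectrum[OF assms] .
  ultimately show ?thesis
    by blast
qed

end
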